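(* Let $\alpha,\beta,\gamma,\delta$ satisfy the standing assumptions below and let $\mathcal{P}=\{(A_n,B_n)\mid n\ge 0\}\cup\{(B_n,A_n)\mid n\ge 0\}$. If the $4$-tuple $(\alpha,\beta,\gamma,\delta)$ is good, then the invariant game with set of moves $\mathcal{M}=\mathbb{N}^2\setminus(\mathcal{P}-\mathcal{P})$, where $\mathcal{P}-\mathcal{P}=\{p-q\mid p,q\in\mathcal{P}\}$, has $\mathcal{P}$ as its set of $P$-positions.
   Context: Standing assumptions: $\alpha<\beta$ are positive irrational numbers with $\frac1\alpha+\frac1\beta=1$; $\gamma,\delta$ are real numbers with $\gamma\neq 0$, $\frac{\gamma}{\alpha}+\frac{\delta}{\beta}=0$, and $n\beta+\delta\notin\mathbb{Z}$ for all integers $n\ge1$. Set $A_0=B_0=0$ and $A_n=\lfloor n\alpha+\gamma\rfloor$, $B_n=\lfloor n\beta+\delta\rfloor$ for $n\ge1$; assume $A_1=1$ and $B_1\ge 3$. Invariant games: positions are pairs $(x,y)\in\mathbb{N}^2$. A game is given by a set $\mathcal{M}\subseteq\mathbb{N}^2\setminus\{(0,0)\}$ of moves; from $(x,y)$ a player may play any $m\in\mathcal{M}$ with $m\le(x,y)$ componentwise, reaching $(x,y)-m$. Players alternate and the player making the last move wins. A position is a $P$-position iff no move from it leads to a $P$-position. The word $\mathbf{w}=w_0w_1w_2\cdots$: $w_n=(A_{n+1}-A_n,B_{n+1}-B_n)$ for $n\ge0$ (so $w_0=(1,B_1)$). Write $a=(1,\lfloor\beta\rfloor)$, $b=(1,\lfloor\beta\rfloor+1)$,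 $c=(2,\lfloor\beta\rfloor)$, $d=(2,\lfloor\beta\rfloor+1)$; for $n\ge1$, $w_n\in\{a,b,c,d\}$. Let $\pi_1,\pi_2$ be the coordinate projections. For a finite word $v$, $|v|_x$ is the number of occurrences of $x$, and $\Psi(v)=(|v|_a,|v|_b,|v|_c,|v|_d)$. $\mathrm{Fac}_n(\mathbf{w})$ is the set of factors of length $n$ of $\mathbf{w}$. Bad prefix: a prefix $p=w_0u_1\cdots u_n$, $u=u_1\cdots u_n$, is bad if $u\in\{a,b\}^*$, $u_1\cdots u_{n-1}$ is a palindrome, and one of: (i) $2B_1=\pi_2(u_n)-1$ and some $v\in\mathrm{Fac}_n(\mathbf{w})$ has $\Psi(v)=\Psi(u)+(0,-1,1,0)$ or $\Psi(u)+(1,-2,0,1)$; (ii) $2B_1=\pi_2(u_n)$ and some $v\in\mathrm{Fac}_n(\mathbf{w})$ has $\Psi(v)=\Psi(u)+(-1,0,1,0)$ or $\Psi(u)+(0,-1,0,1)$; (iii) $2B_1=\pi_2(u_n)+1$ and some $v\in\mathrm{Fac}_n(\mathbf{w})$ has $\Psi(v)=\Psi(u)+(-1,0,0,1)$ or $\Psi(u)+(-2,1,1,0)$. Suffix-bad: a factor $u=u_1\cdots u_n\in\{a,b\}^*$ of $\mathbf{w}$ satisfies (B.1) if some $v\in\mathrm{Fac}_n(\mathbf{w})\cap\{a,b\}^*$ has $\Psi(v)=\Psi(u)+(j,-j,0,0)$ with $j>0$; it satisfies (B.2) if some $v'\in\mathrm{Fac}_{n-1}(\mathbf{w})$ has $\Psi(v')=\Psi(u_1\cdots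 u_{n-1})+(0,-1,1,0)$ or $\Psi(u_1\cdots u_{n-1})+(1,-2,0,1)$. $u$ is suffix-bad if all suffixes $u_j\cdots u_n$ ($1\le j\le n$) satisfy (B.1), or all suffixes $u_j\cdots u_n$ ($1\le j\le n-1$) satisfy (B.2). Good: either $\gamma>0$ and no prefix $w_0w_1\cdots w_k$ with $1\le k\le B_1-2$ and $w_1,\dots,w_k\in\{a,b\}$ is bad; or $\gamma<0$ and no prefix of $\mathbf{w}$ in $\{a,b\}^*$ of length less than $B_1$ is suffix-bad. *)

theory Defs
  imports
    Complex_Main
    "HOL-Library.Product_Plus"
    "HOL-Library.Product_Order"
    "HOL-Library.Omega_Words_Fun"
begin

section \<open>Invariant games\<close>

text \<open>
  Addition, subtraction and the order on pairs are componentwise. The move \<open>(0, 0)\<close> is never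
  allowed: the guard \<open>m \<noteq> 0\<close> has this effect even for a set \<open>M\<close> that contains \<open>(0, 0)\<close>,
  and it makes the recursion terminate.
\<close>

function P_position :: "(nat \<times> nat) set \<Rightarrow> nat \<times> nat \<Rightarrow> bool" where
  "P_position M p \<longleftrightarrow> (\<forall>m\<in>M. m \<noteq> 0 \<and> m \<le> p \<longrightarrow> \<not> P_position M (p - m))"
  by pat_completeness auto
termination
  by (relation "measure (\<lambda>(M, p). fst p + snd p)")
     (auto simp: less_eq_prod_def prod_eq_iff)

declare P_position.simps [simp del]

definition int_pair :: "nat \<times> nat \<Rightarrow> int \<times> int" where
  "int_pair p = (int (fst p), int (snd p))"

text \<open>
  The moves \<open>\<nat>\<^sup>2 \<setminus> (S - S)\<close>; differences are formed in \<open>\<int>\<^sup>2\<close>, so that subtraction is not truncated.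
\<close>

definition difference_free_moves :: "(int \<times> int) set \<Rightarrow> (nat \<times> nat) set" where
  "difference_free_moves S = {m. int_pair m \<notin> {p - q | p q. p \<in> S \<and> q \<in> S}}"


section \<open>Beatty sequences and the associated word\<close>

text \<open>The value at \<open>0\<close> is \<open>0\<close> by convention, not \<open>\<lfloor>\<rho>\<rfloor>\<close>.\<close>

definition beatty :: "real \<Rightarrow> real \<Rightarrow> nat \<Rightarrow> int" where
  "beatty \<theta> \<rho> n = (if n = 0 then 0 else \<lfloor>real n * \<theta> + \<rho>\<rfloor>)"

definition beatty_pairs :: "real \<Rightarrow> real \<Rightarrow> real \<Rightarrow> real \<Rightarrow> (int \<times> int) set" where
  "beatty_pairs \<alpha> \<beta> \<gamma> \<delta> =
     {(beatty \<alpha> \<gamma> n, beatty \<beta> \<delta> n) | n. True} \<union> {(beatty \<beta> \<delta> n, beatty \<alpha> \<gamma> n) | n. True}"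

type_synonym letter = "int \<times> int"

definition beatty_word :: "real \<Rightarrow> real \<Rightarrow> real \<Rightarrow> real \<Rightarrow> letter word" where
  "beatty_word \<alpha> \<beta> \<gamma> \<delta> n =
     (beatty \<alpha> \<gamma> (Suc n) - beatty \<alpha> \<gamma> n, beatty \<beta> \<delta> (Suc n) - beatty \<beta> \<delta> n)"

definition letter_a :: "real \<Rightarrow> letter" where "letter_a \<beta> = (1, \<lfloor>\<beta>\<rfloor>)"
definition letter_b :: "real \<Rightarrow> letter" where "letter_b \<beta> = (1, \<lfloor>\<beta>\<rfloor> + 1)"
definition letter_c :: "real \<Rightarrow> letter" where "letter_c \<beta> = (2, \<lfloor>\<beta>\<rfloor>)"
definition letter_d :: "real \<Rightarrow> letter" where "letter_d \<beta> = (2, \<lfloor>\<beta>\<rfloor> + 1)"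

definition ab_word :: "real \<Rightarrow> letter list \<Rightarrow> bool" where
  "ab_word \<beta> u \<longleftrightarrow> set u \<subseteq> {letter_a \<beta>, letter_b \<beta>}"

definition parikh :: "real \<Rightarrow> letter list \<Rightarrow> int \<times> int \<times> int \<times> int" where
  "parikh \<beta> v =
     (int (count_list v (letter_a \<beta>)), int (count_list v (letter_b \<beta>)),
      int (count_list v (letter_c \<beta>)), int (count_list v (letter_d \<beta>)))"

definition factors :: "nat \<Rightarrow> 'a word \<Rightarrow> 'a list set" where
  "factors n w = {subsequence w i (i + n) | i. True}"


section \<open>Bad prefixes\<close>

text \<open>
  In the following two definitions \<open>\<beta>\<close> only determines the alphabet. As \<open>w 0 = (1, B\<^sub>1)\<close>,
  the number \<open>B\<^sub>1\<close> is \<open>snd (w 0)\<close>.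
\<close>

definition has_factor_shifted ::
  "real \<Rightarrow> letter word \<Rightarrow> letter list \<Rightarrow> int \<times> int \<times> int \<times> int \<Rightarrow> bool" where
  "has_factor_shifted \<beta> w u s \<longleftrightarrow> (\<exists>v \<in> factors (length u) w. parikh \<beta> v = parikh \<beta> u + s)"

definition bad_prefix :: "real \<Rightarrow> letter word \<Rightarrow> letter list \<Rightarrow> bool" where
  "bad_prefix \<beta> w p \<longleftrightarrow>
     (\<exists>u. u \<noteq> [] \<and> p = w 0 # u \<and> p = prefix (length p) w \<and>
        ab_word \<beta> u \<and> rev (butlast u) = butlast u \<and>
        (2 * snd (w 0) = snd (last u) - 1 \<and>
           (has_factor_shifted \<beta> w u (0, -1, 1, 0) \<or> has_factor_shifted \<beta> w u (1, -2, 0, 1)) \<or>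
         2 * snd (w 0) = snd (last u) \<and>
           (has_factor_shifted \<beta> w u (-1, 0, 1, 0) \<or> has_factor_shifted \<beta> w u (0, -1, 0, 1)) \<or>
         2 * snd (w 0) = snd (last u) + 1 \<and>
           (has_factor_shifted \<beta> w u (-1, 0, 0, 1) \<or> has_factor_shifted \<beta> w u (-2, 1, 1, 0))))"


section \<open>Suffix-bad factors\<close>

definition cond_B1 :: "real \<Rightarrow> letter word \<Rightarrow> letter list \<Rightarrow> bool" where
  "cond_B1 \<beta> w u \<longleftrightarrow>
     (\<exists>v \<in> factors (length u) w. ab_word \<beta> v \<and> (\<exists>j>0. parikh \<beta> v = parikh \<beta> u + (j, -j, 0, 0)))"

definition cond_B2 :: "real \<Rightarrow> letter word \<Rightarrow> letter list \<Rightarrow> bool" where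
  "cond_B2 \<beta> w u \<longleftrightarrow>
     has_factor_shifted \<beta> w (butlast u) (0, -1, 1, 0) \<or>
     has_factor_shifted \<beta> w (butlast u) (1, -2, 0, 1)"

text \<open>
  The word \<open>drop i u\<close> is the suffix of \<open>u = u\<^sub>1\<dots>u\<^sub>n\<close> that starts with \<open>u\<^sub>j\<close> for \<open>j = i + 1\<close>.
  Neither alternative may hold vacuously: the first needs \<open>n \<ge> 1\<close> and the second \<open>n \<ge> 2\<close>.
  Otherwise the empty word would be suffix-bad, and so would every word of length one.
\<close>

definition suffix_bad :: "real \<Rightarrow> letter word \<Rightarrow> letter list \<Rightarrow> bool" where
  "suffix_bad \<beta> w u \<longleftrightarrow>
     u \<in> factors (length u) w \<and> ab_word \<beta> u \<and>
     (1 \<le> length u \<and> (\<forall>i < length u. cond_B1 \<beta> w (drop i u)) \<or>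
      2 \<le> length u \<and> (\<forall>i < length u - 1. cond_B2 \<beta> w (drop i u)))"


section \<open>Good tuples\<close>

definition good :: "real \<Rightarrow> real \<Rightarrow> real \<Rightarrow> real \<Rightarrow> bool" where
  "good \<alpha> \<beta> \<gamma> \<delta> \<longleftrightarrow>
     (let w = beatty_word \<alpha> \<beta> \<gamma> \<delta>; B\<^sub>1 = beatty \<beta> \<delta> 1 in
      (\<gamma> > 0 \<and>
         (\<forall>k. 1 \<le> k \<and> int k \<le> B\<^sub>1 - 2 \<and> ab_word \<beta> (subsequence w 1 (k + 1)) \<longrightarrow>
            \<not> bad_prefix \<beta> w (prefix (k + 1) w))) \<or>
      (\<gamma> < 0 \<and>
         (\<forall>k. int k < B\<^sub>1 \<and> ab_word \<beta> (prefix k w) \<longrightarrow> \<not> suffix_bad \<beta> w (prefix k w))))"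

end

theory Submission
  imports Defs
begin

text \<open>
  No move avoiding \<open>S - S\<close> joins two points of \<open>S\<close>, so what matters is that no position \<open>(x, y)\<close>
  outside \<open>S\<close> is stuck, i.e. has all its differences to smaller points of \<open>S\<close> in \<open>S - S\<close>. By symmetry
  let \<open>x \<le> y\<close>. Differences of \<open>(A\<^sub>i, B\<^sub>i)\<close> and \<open>(A\<^sub>j, B\<^sub>j)\<close> lie along the ray of slope \<open>\<beta>/\<alpha>\<close>, those of
  \<open>(A\<^sub>i, B\<^sub>i)\<close> and \<open>(B\<^sub>j, A\<^sub>j)\<close> lie well above it, and nothing lies between the diagonal and the ray.
  A stuck position therefore has \<open>x = A\<^sub>n\<close>, \<open>y < B\<^sub>n\<close> and is a difference of the first kind, with
  \<open>i - j \<in> {n - 1, n}\<close>; subtracting \<open>(B\<^sub>1, A\<^sub>1)\<close> shows \<open>x < B\<^sub>1\<close>, hence \<open>x = n\<close>.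

  If \<open>\<gamma> > 0\<close>, subtracting \<open>(A\<^sub>n\<^sub>-\<^sub>1, B\<^sub>n\<^sub>-\<^sub>1)\<close> forces \<open>y = B\<^sub>n\<^sub>-\<^sub>1 + B\<^sub>1\<close>. Subtracting the points of smaller index
  then gives points of \<open>S\<close> again, which makes \<open>w\<^sub>1 \<dots> w\<^sub>n\<^sub>-\<^sub>2\<close> a palindrome and \<open>w\<^sub>0 \<dots> w\<^sub>n\<^sub>-\<^sub>1\<close> a bad prefix.
  If \<open>\<gamma> < 0\<close>, then \<open>y = B\<^sub>n - 1\<close> or \<open>y = B\<^sub>n\<^sub>-\<^sub>1 - 1\<close>, and subtracting \<open>(A\<^sub>m, B\<^sub>m)\<close> shows condition (B.1) or (B.2)
  for the suffix of \<open>w\<^sub>0 \<dots> w\<^sub>n\<^sub>-\<^sub>1\<close> that starts at \<open>w\<^sub>m\<close>.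
\<close>

section \<open>Dual subtraction games\<close>

lemma int_pair_diff: "m \<le> p \<Longrightarrow> int_pair (p - m) = int_pair p - int_pair m"
  by (auto simp: int_pair_def less_eq_prod_def of_nat_diff)

lemma P_positions_eq_if_escape:
  fixes S :: "(int \<times> int) set"
  assumes nonneg: "\<And>s t. (s, t) \<in> S \<Longrightarrow> 0 \<le> s \<and> 0 \<le> t"
    and escape: "\<And>x y. \<lbrakk>0 \<le> x; 0 \<le> y; (x, y) \<notin> S\<rbrakk> \<Longrightarrow>
      \<exists>s t. (s, t) \<in> S \<and> s \<le> x \<and> t \<le> y \<and> (x - s, y - t) \<notin> {p - q | p q. p \<in> S \<and> q \<in> S}"
  shows "int_pair ` {p. P_position (difference_free_moves S) p} = S"
proof -
  have iff: "P_position (difference_free_moves S) p \<longleftrightarrow> int_pair p \<in> S" for p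
  proof (induction p rule: measure_induct_rule[where f = "\<lambda>p. fst p + snd p"])
    case (less p)
    have IH: "P_position (difference_free_moves S) (p - m) \<longleftrightarrow> int_pair p - int_pair m \<in> S"
      if "m \<noteq> 0" "m \<le> p" for m
    proof -
      have "fst (p - m) + snd (p - m) < fst p + snd p"
        using that by (cases p; cases m) (auto simp: less_eq_prod_def prod_eq_iff)
      from less[OF this] show ?thesis
        by (simp add: int_pair_diff[OF \<open>m \<le> p\<close>])
    qed
    show ?case
    proof
      assume inS: "int_pair p \<in> S"
      have "\<not> P_position (difference_free_moves S) (p - m)"
        if "m \<in> difference_free_moves S" "m \<noteq> 0" "m \<le> p" for m
      proof
        assume "P_position (difference_free_moves S) (p - m)"
        then have "int_pair p - int_pair m \<in> S"
          using IH that by blast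
        moreover have "int_pair m = int_pair p - (int_pair p - int_pair m)"
          by simp
        ultimately show False
          using inS \<open>m \<in> difference_free_moves S\<close> unfolding difference_free_moves_def by blast
      qed
      then show "P_position (difference_free_moves S) p"
        by (subst P_position.simps) blast
    next
      assume P: "P_position (difference_free_moves S) p"
      show "int_pair p \<in> S"
      proof (rule ccontr)
        assume notin: "int_pair p \<notin> S"
        have "\<exists>s t. (s, t) \<in> S \<and> s \<le> int (fst p) \<and> t \<le> int (snd p) \<and>
            (int (fst p) - s, int (snd p) - t) \<notin> {p - q | p q. p \<in> S \<and> q \<in> S}"
          using escape[of "int (fst p)" "int (snd p)"] notin by (simp add: int_pair_def)
        then obtain s t where st: "(s, t) \<in> S" "s \<le> int (fst p)" "t \<le> int (snd p)"
          "(int (fst p) - s, int (snd p) - t) \<notin> {p - q | p q. p \<in> S \<and> q \<in> S}"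
          by blast
        define m where "m = (nat (int (fst p) - s), nat (int (snd p) - t))"
        have m: "int_pair m = (int (fst p) - s, int (snd p) - t)"
          using st by (simp add: m_def int_pair_def)
        have diff: "int_pair p - int_pair m = (s, t)"
          unfolding m by (simp add: int_pair_def)
        have "m \<le> p"
          using nonneg[OF st(1)] by (auto simp: m_def less_eq_prod_def)
        moreover have "m \<noteq> 0"
        proof
          assume "m = 0"
          then have "int_pair p = (s, t)"
            using diff by (simp add: int_pair_def)
          with st(1) notin show False by simp
        qed
        moreover have "m \<in> difference_free_moves S"
          using st(4) by (simp add: difference_free_moves_def m)
        ultimately show False
          using P IH[of m] st(1) diff by (subst (asm) P_position.simps) simp
      qed
    qed
  qed
  have "S \<subseteq> range int_pair"
  proof
    fix p assume "p \<in> S"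
    then have "p = int_pair (nat (fst p), nat (snd p))"
      using nonneg[of "fst p" "snd p"] by (simp add: int_pair_def)
    then show "p \<in> range int_pair" by blast
  qed
  then show ?thesis
    unfolding iff by auto
qed


section \<open>Letter counts\<close>

abbreviation letters :: "real \<Rightarrow> letter set" where
  "letters \<beta> \<equiv> {letter_a \<beta>, letter_b \<beta>, letter_c \<beta>, letter_d \<beta>}"

lemmas letter_defs = letter_a_def letter_b_def letter_c_def letter_d_def

lemma letter_sums:
  assumes "set v \<subseteq> letters \<beta>" "parikh \<beta> v = (a, b, c, d)"
  shows "int (length v) = a + b + c + d"
    and "sum_list (map fst v) = int (length v) + c + d"
    and "sum_list (map snd v) = \<lfloor>\<beta>\<rfloor> * int (length v) + b + d"
proof -
  have "int (length v) = a + b + c + d \<and> sum_list (map fst v) = int (length v) + c + d \<and>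
      sum_list (map snd v) = \<lfloor>\<beta>\<rfloor> * int (length v) + b + d"
    using assms
  proof (induction v arbitrary: a b c d)
    case (Cons x v)
    then show ?case
      by (auto simp: parikh_def letter_defs algebra_simps)
  qed (simp add: parikh_def)
  then show "int (length v) = a + b + c + d"
    and "sum_list (map fst v) = int (length v) + c + d"
    and "sum_list (map snd v) = \<lfloor>\<beta>\<rfloor> * int (length v) + b + d"
    by auto
qed

lemma parikh_nonneg: "parikh \<beta> v = (a, b, c, d) \<Longrightarrow> 0 \<le> a \<and> 0 \<le> b \<and> 0 \<le> c \<and> 0 \<le> d"
  by (auto simp: parikh_def)

lemma parikh_ab_word:
  assumes "ab_word \<beta> u"
  obtains a b where "parikh \<beta> u = (a, b, 0, 0)"
proof -
  have "letter_c \<beta> \<notin> set u" "letter_d \<beta> \<notin> set u"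
    using assms by (auto simp: ab_word_def letter_defs)
  then show thesis
    using that by (simp add: parikh_def)
qed

lemma ab_wordI:
  assumes "set v \<subseteq> letters \<beta>" "parikh \<beta> v = (a, b, 0, 0)"
  shows "ab_word \<beta> v"
proof -
  have "letter_c \<beta> \<notin> set v" "letter_d \<beta> \<notin> set v"
    using assms(2) by (auto simp: parikh_def count_list_0_iff)
  then show ?thesis
    using assms(1) by (auto simp: ab_word_def)
qed

text \<open>The excess 1 in the first coordinates means that exactly one letter of \<open>v\<close>
  is \<open>c\<close> or \<open>d\<close>; which of them gives the two alternatives. The values -1,
  0, 1 of \<open>t\<close> yield the shifts in the three clauses of \<open>bad_prefix\<close>, and
  -1 also those of (B.2).\<close>

lemma parikh_shift:
  assumes "ab_word \<beta> u" "set v \<subseteq> letters \<beta>" "length v = length u"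
    and "sum_list (map fst v) = int (length u) + 1"
    and "sum_list (map snd v) = sum_list (map snd u) + t"
  shows "parikh \<beta> v = parikh \<beta> u + (- 1 - t, t, 1, 0) \<or>
         parikh \<beta> v = parikh \<beta> u + (- t, t - 1, 0, 1)"
proof -
  obtain a b where u: "parikh \<beta> u = (a, b, 0, 0)"
    using parikh_ab_word[OF assms(1)] .
  obtain a' b' c' d' where v: "parikh \<beta> v = (a', b', c', d')"
    by (cases "parikh \<beta> v")
  have "set u \<subseteq> letters \<beta>"
    using assms(1) by (auto simp: ab_word_def)
  note su = letter_sums[OF this u] and sv = letter_sums[OF assms(2) v]
  have "c' + d' = 1" "a' + b' + 1 = a + b" "b' + d' = b + t"
    using su sv assms(3-5) by auto
  then have "c' = 1 \<and> d' = 0 \<and> b' = b + t \<and> a' = a - 1 - t \<or>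
      c' = 0 \<and> d' = 1 \<and> b' = b + t - 1 \<and> a' = a - t"
    using parikh_nonneg[OF v] by presburger
  then show ?thesis
    using u v by auto
qed

text \<open>Without excess in the first coordinates \<open>c\<close> and \<open>d\<close> cannot
  occur, so \<open>t\<close> counts the additional letters \<open>b\<close>. The value -1 gives
  (B.1) with \<open>j = 1\<close>.\<close>

lemma parikh_shift_ab:
  assumes "ab_word \<beta> u" "set v \<subseteq> letters \<beta>" "length v = length u"
    and "sum_list (map fst v) = int (length u)"
    and "sum_list (map snd v) = sum_list (map snd u) + t"
  shows "ab_word \<beta> v" "parikh \<beta> v = parikh \<beta> u + (- t, t, 0, 0)"
proof -
  obtain a b where u: "parikh \<beta> u = (a, b, 0, 0)"
    using parikh_ab_word[OF assms(1)] .
  obtain a' b' c' d' where v: "parikh \<beta> v = (a', b', c', d')"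
    by (cases "parikh \<beta> v")
  have "set u \<subseteq> letters \<beta>"
    using assms(1) by (auto simp: ab_word_def)
  note su = letter_sums[OF this u] and sv = letter_sums[OF assms(2) v]
  have cd: "c' = 0" "d' = 0"
    using sv(2) assms(3,4) parikh_nonneg[OF v] by auto
  then show "ab_word \<beta> v"
    using ab_wordI[OF assms(2)] v by blast
  have "a' + b' = a + b" "b' = b + t"
    using su sv assms(3-5) cd by auto
  then show "parikh \<beta> v = parikh \<beta> u + (- t, t, 0, 0)"
    using u v cd by auto
qed


section \<open>Complementary Beatty sequences\<close>

locale complementary_beatty =
  fixes \<alpha> \<beta> \<gamma> \<delta> :: real
  assumes \<alpha>_pos: "0 < \<alpha>" and \<alpha>_less_\<beta>: "\<alpha> < \<beta>"
    and \<beta>_irrational: "\<beta> \<notin> \<rat>"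
    and inverse_sum: "1 / \<alpha> + 1 / \<beta> = 1"
    and offset_sum: "\<gamma> / \<alpha> + \<delta> / \<beta> = 0"
    and not_Ints: "\<And>n::nat. n \<ge> 1 \<Longrightarrow> real n * \<beta> + \<delta> \<notin> \<int>"
    and beatty_\<alpha>_1: "beatty \<alpha> \<gamma> 1 = 1"
    and beatty_\<beta>_1: "beatty \<beta> \<delta> 1 \<ge> 3"
begin

abbreviation A :: "nat \<Rightarrow> int" where "A \<equiv> beatty \<alpha> \<gamma>"
abbreviation B :: "nat \<Rightarrow> int" where "B \<equiv> beatty \<beta> \<delta>"
definition b0 :: int where "b0 = \<lfloor>\<beta>\<rfloor>"

section \<open>Bounds on the slopes, the offsets and the terms\<close>

lemma \<beta>_pos: "0 < \<beta>"
  using \<alpha>_pos \<alpha>_less_\<beta> by simp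

lemma product_eq_sum: "\<alpha> * \<beta> = \<alpha> + \<beta>"
  using inverse_sum \<alpha>_pos \<beta>_pos by (simp add: field_simps)

lemma \<alpha>_gt_1: "1 < \<alpha>"
proof (rule ccontr)
  assume "\<not> 1 < \<alpha>"
  then have "\<alpha> * \<beta> \<le> 1 * \<beta>"
    using \<beta>_pos by (intro mult_right_mono) auto
  then show False using product_eq_sum \<alpha>_pos by simp
qed

lemma \<alpha>_less_2: "\<alpha> < 2"
proof (rule ccontr)
  assume "\<not> \<alpha> < 2"
  then have "2 * \<beta> \<le> \<alpha> * \<beta>"
    using \<beta>_pos by (intro mult_right_mono) auto
  then show False using product_eq_sum \<alpha>_less_\<beta> by simp
qed

lemma \<beta>_gt_2: "2 < \<beta>"
proof (rule ccontr)
  assume "\<not> 2 < \<beta>"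
  then have "\<alpha> * \<beta> \<le> \<alpha> * 2"
    using \<alpha>_pos by (intro mult_left_mono) auto
  then show False using product_eq_sum \<alpha>_less_\<beta> by simp
qed

lemma b0_ge_2: "2 \<le> b0"
  using \<beta>_gt_2 unfolding b0_def by linarith

lemma b0_bounds: "of_int b0 \<le> \<beta>" "\<beta> < of_int b0 + 1"
  unfolding b0_def by linarith+

lemma offset_relation: "\<gamma> * \<beta> = - \<delta> * \<alpha>"
  using offset_sum \<alpha>_pos \<beta>_pos by (simp add: field_simps)

lemma A_bounds:
  assumes "n \<ge> 1"
  shows "real n * \<alpha> + \<gamma> - 1 < A n" "A n \<le> real n * \<alpha> + \<gamma>"
proof -
  have "A n = \<lfloor>real n * \<alpha> + \<gamma>\<rfloor>" using assms by (simp add: beatty_def)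
  then show "real n * \<alpha> + \<gamma> - 1 < A n" "A n \<le> real n * \<alpha> + \<gamma>" by linarith+
qed

lemma B_bounds: "n \<ge> 1 \<Longrightarrow> real n * \<beta> + \<delta> - 1 < B n" "n \<ge> 1 \<Longrightarrow> B n < real n * \<beta> + \<delta>"
proof -
  assume n: "n \<ge> 1"
  then have eq: "B n = \<lfloor>real n * \<beta> + \<delta>\<rfloor>" by (simp add: beatty_def)
  show "real n * \<beta> + \<delta> - 1 < B n" unfolding eq by linarith
  have "real n * \<beta> + \<delta> \<noteq> B n" using not_Ints[OF n] by (metis Ints_of_int)
  then show "B n < real n * \<beta> + \<delta>" unfolding eq by linarith
qed

lemma A_0 [simp]: "A 0 = 0" and B_0 [simp]: "B 0 = 0"
  by (auto simp: beatty_def)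

lemmas A_1 = beatty_\<alpha>_1[unfolded One_nat_def]
lemmas B_1 = beatty_\<beta>_1[unfolded One_nat_def]

lemma \<gamma>_bounds: "1 - \<alpha> \<le> \<gamma>" "\<gamma> < 2 - \<alpha>"
  using A_bounds[of 1] A_1 by auto

lemma \<delta>_ge: "3 - \<beta> < \<delta>"
  using B_bounds[of 1] B_1 by auto

text \<open>The bound \<open>1 - \<alpha> \<le> \<gamma>\<close> stems from \<open>A 1 = 1\<close>;
  the offset relation carries it over to \<delta>.\<close>

lemma \<delta>_le_1: "\<delta> \<le> 1"
proof -
  have "\<delta> * \<alpha> = - \<gamma> * \<beta>" using offset_relation by simp
  also have "\<dots> \<le> (\<alpha> - 1) * \<beta>"
    using \<gamma>_bounds \<beta>_pos by (intro mult_right_mono) auto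
  also have "\<dots> = 1 * \<alpha>" using product_eq_sum by (simp add: algebra_simps)
  finally show ?thesis using \<alpha>_pos mult_le_cancel_right_pos by blast
qed

lemma offset_signs: "0 < \<gamma> \<longleftrightarrow> \<delta> < 0" "\<gamma> < 0 \<longleftrightarrow> 0 < \<delta>"
proof -
  have "\<gamma> = - \<delta> * \<alpha> / \<beta>"
    using offset_relation \<beta>_pos by (simp add: field_simps)
  then show "0 < \<gamma> \<longleftrightarrow> \<delta> < 0" "\<gamma> < 0 \<longleftrightarrow> 0 < \<delta>"
    using \<alpha>_pos \<beta>_pos by (auto simp: zero_less_divide_iff divide_less_0_iff mult_less_0_iff zero_less_mult_iff)
qed

section \<open>Step sizes and monotonicity\<close>

lemma A_step:
  assumes "n \<ge> 1"
  shows "A (Suc n) - A n \<in> {1, 2}"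
proof -
  have "0 < A (Suc n) - A n" "A (Suc n) - A n < 3"
    using A_bounds[of n] A_bounds[of "Suc n"] \<alpha>_gt_1 \<alpha>_less_2 assms
    by (simp_all add: algebra_simps)
  then show ?thesis by auto
qed

lemma A_step': "A (Suc n) - A n \<in> {1, 2}"
  using A_step[of n] A_1 by (cases n) auto

lemma B_step:
  assumes "n \<ge> 1"
  shows "B (Suc n) - B n \<in> {b0, b0 + 1}"
proof -
  have "b0 - 1 < B (Suc n) - B n" "B (Suc n) - B n < b0 + 2"
    using B_bounds[of n] B_bounds[of "Suc n"] b0_bounds assms
    by (simp_all add: algebra_simps)
  then show ?thesis by auto
qed

lemma A_diff_bounds:
  "j \<le> i \<Longrightarrow> int i - int j \<le> A i - A j \<and> A i - A j \<le> 2 * (int i - int j)"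
proof (induction rule: dec_induct)
  case (step n)
  then show ?case using A_step'[of n] by auto
qed simp

lemma B_diff_ge: "\<lbrakk>j \<le> i; 1 \<le> j\<rbrakk> \<Longrightarrow> b0 * (int i - int j) \<le> B i - B j"
proof (induction rule: dec_induct)
  case (step n)
  then show ?case using B_step[of n] by (auto simp: algebra_simps)
qed simp

lemma A_strict_mono: "i < j \<Longrightarrow> A i < A j"
  using A_diff_bounds[of i j] by simp

lemma A_less_iff [simp]: "A i < A j \<longleftrightarrow> i < j"
  using A_strict_mono[of i j] A_strict_mono[of j i] by (metis linorder_neqE_nat order_less_asym)

lemma A_le_iff [simp]: "A i \<le> A j \<longleftrightarrow> i \<le> j"
  by (meson A_less_iff not_le)

lemma A_eq_iff [simp]: "A i = A j \<longleftrightarrow> i = j"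
  by (metis A_le_iff order_antisym order_refl)

lemma D_ge_2: "n \<ge> 1 \<Longrightarrow> A n + 2 \<le> B n"
proof (induction n rule: nat_induct_at_least)
  case base
  then show ?case using A_1 B_1 by simp
next
  case (Suc n)
  then show ?case using A_step[of n] B_step[of n] b0_ge_2 by auto
qed

lemma A_le_B: "A n \<le> B n"
  using D_ge_2[of n] by (cases n) auto

lemma A_nonneg: "0 \<le> A n" and A_pos: "n \<ge> 1 \<Longrightarrow> 1 \<le> A n"
  using A_diff_bounds[of 0 n] by auto

lemma B_nonneg: "0 \<le> B n"
  using A_nonneg A_le_B order_trans by blast

lemma B_mono: "j \<le> i \<Longrightarrow> B j \<le> B i"
proof (cases "j = 0")
  case False
  assume "j \<le> i"
  then have "b0 * (int i - int j) \<le> B i - B j" "0 \<le> b0 * (int i - int j)"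
    using B_diff_ge[of j i] b0_ge_2 False by auto
  then show ?thesis by linarith
qed (simp add: B_nonneg)

section \<open>Complementarity of the two sequences\<close>

lemma A_neq_B:
  assumes "n \<ge> 1" "m \<ge> 1"
  shows "A n \<noteq> B m"
proof
  assume eq: "A n = B m"
  define k :: real where "k = A n"
  \<comment> \<open>Weighting the bounds for \<open>A n\<close> by \<beta> and those for
    \<open>B m\<close> by \<alpha> cancels the offsets in the sum. Dividing by
    \<open>\<alpha> * \<beta> = \<alpha> + \<beta>\<close> then squeezes \<open>n + m\<close>
    strictly between \<open>k\<close> and \<open>k + 1\<close>.\<close>
  have "k * \<beta> \<le> (real n * \<alpha> + \<gamma>) * \<beta>" "(real n * \<alpha> + \<gamma>) * \<beta> < (k + 1) * \<beta>"
    using A_bounds[OF assms(1)] \<beta>_pos unfolding k_def by (auto intro!: mult_right_mono)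
  moreover have "k * \<alpha> < (real m * \<beta> + \<delta>) * \<alpha>" "(real m * \<beta> + \<delta>) * \<alpha> < (k + 1) * \<alpha>"
    using B_bounds[OF assms(2)] \<alpha>_pos unfolding k_def eq by (auto intro!: mult_right_mono)
  ultimately have "k * (\<alpha> + \<beta>) < (real n + real m) * (\<alpha> * \<beta>)"
    "(real n + real m) * (\<alpha> * \<beta>) < (k + 1) * (\<alpha> + \<beta>)"
    using offset_relation by (auto simp: algebra_simps)
  then have "k < real n + real m" "real n + real m < k + 1"
    using product_eq_sum \<alpha>_pos \<beta>_pos by (auto simp: mult_less_cancel_right)
  then have "A n < int n + int m" "int n + int m < A n + 1"
    unfolding k_def by linarith+
  then show False by linarith
qed

text \<open>\<open>Suc n\<close> is the first positive index whose unrounded term reaches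
  \<open>k\<close>; its floor is not \<open>k\<close>, so the term even reaches
  \<open>k + 1\<close>.\<close>

lemma beatty_gap:
  fixes \<theta> \<rho> :: real and k :: int
  assumes "0 < \<theta>" "\<rho> \<le> k" "\<And>n. n \<ge> 1 \<Longrightarrow> beatty \<theta> \<rho> n \<noteq> k"
  obtains n :: nat where "real n * \<theta> + \<rho> \<le> k" "k + 1 \<le> real (Suc n) * \<theta> + \<rho>"
proof -
  define P where "P n \<longleftrightarrow> k \<le> real (Suc n) * \<theta> + \<rho>" for n :: nat
  obtain N :: nat where "(k - \<rho>) / \<theta> < N"
    using reals_Archimedean2 by blast
  then have "P N"
    using assms(1) by (simp add: P_def field_simps)
  define n where "n = (LEAST n. P n)"
  have "P n"
    unfolding n_def using \<open>P N\<close> by (rule LeastI)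
  then have "k \<le> beatty \<theta> \<rho> (Suc n)"
    by (simp add: P_def beatty_def le_floor_iff)
  then have "k + 1 \<le> beatty \<theta> \<rho> (Suc n)"
    using assms(3)[of "Suc n"] by simp
  then have "k + 1 \<le> real (Suc n) * \<theta> + \<rho>"
    by (simp add: beatty_def le_floor_iff)
  moreover have "real n * \<theta> + \<rho> \<le> k"
  proof (cases n)
    case 0
    then show ?thesis using assms(2) by simp
  next
    case (Suc m)
    then have "\<not> P m"
      using not_less_Least[of m P] n_def by simp
    then show ?thesis using Suc by (simp add: P_def)
  qed
  ultimately show ?thesis using that by blast
qed

text \<open>If both sequences miss \<open>k\<close>, the weighted sum of \<open>A_neq_B\<close> puts
  \<open>k\<close> strictly between \<open>n + m\<close> and \<open>n + m + 1\<close>.\<close>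

lemma A_or_B:
  fixes k :: int
  assumes "k \<ge> 1"
  shows "\<exists>n\<ge>1. k = A n \<or> k = B n"
proof (rule ccontr)
  assume neg: "\<not> ?thesis"
  \<comment> \<open>The value 1 is set aside because \<delta> may equal 1, and then the bound for
    \<open>m = 0\<close> is not strict at \<open>k = 1\<close>.\<close>
  have "k \<noteq> 1" using neg A_1 by (metis One_nat_def order_refl)
  obtain n where n: "real n * \<alpha> + \<gamma> \<le> k" "k + 1 \<le> real (Suc n) * \<alpha> + \<gamma>"
    using neg \<alpha>_pos \<gamma>_bounds \<alpha>_gt_1 assms by (elim beatty_gap[of \<alpha> \<gamma> k]) auto
  obtain m where m: "real m * \<beta> + \<delta> \<le> k" "k + 1 \<le> real (Suc m) * \<beta> + \<delta>"
    using neg \<beta>_pos \<delta>_le_1 assms by (elim beatty_gap[of \<beta> \<delta> k]) auto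
  have "real (Suc m) * \<beta> + \<delta> \<noteq> k + 1"
    using not_Ints[of "Suc m"] by (metis Ints_of_int le_add1 plus_1_eq_Suc)
  moreover have "real m * \<beta> + \<delta> \<noteq> k"
  proof (cases "m = 0")
    case True
    then show ?thesis using \<delta>_le_1 assms \<open>k \<noteq> 1\<close> by simp
  next
    case False
    then show ?thesis using not_Ints[of m] by (metis Ints_of_int less_one not_le)
  qed
  ultimately have m': "k + 1 < real (Suc m) * \<beta> + \<delta>" "real m * \<beta> + \<delta> < k"
    using m by simp_all
  have "(real n * \<alpha> + \<gamma>) * \<beta> \<le> k * \<beta>" "(k + 1) * \<beta> \<le> (real (Suc n) * \<alpha> + \<gamma>) * \<beta>"
    using n \<beta>_pos by (auto intro!: mult_right_mono simp del: of_nat_Suc)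
  moreover have "(real m * \<beta> + \<delta>) * \<alpha> < k * \<alpha>" "(k + 1) * \<alpha> < (real (Suc m) * \<beta> + \<delta>) * \<alpha>"
    using m' \<alpha>_pos by (auto intro!: mult_strict_right_mono)
  ultimately have "(real n + real m) * (\<alpha> * \<beta>) < k * (\<alpha> + \<beta>)"
    "(k + 1) * (\<alpha> + \<beta>) < (real n + real m + 2) * (\<alpha> * \<beta>)"
    using offset_relation by (auto simp: algebra_simps)
  then have "real n + real m < k" "k + 1 < real n + real m + 2"
    using product_eq_sum \<alpha>_pos \<beta>_pos by (auto simp: mult_less_cancel_right)
  then have "int n + int m < k" "k < int n + int m + 1"
    by linarith+
  then show False by linarith
qed

text \<open>A step of 2 in \<open>A\<close> skips an integer, which must be a term of
  \<open>B\<close> and hence at least \<open>B 1\<close>.\<close>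

lemma A_eq_self: "A n < B 1 \<Longrightarrow> A n = int n"
proof (induction n)
  case (Suc n)
  then have less: "A n < B 1" using A_strict_mono[of n "Suc n"] by linarith
  have "A (Suc n) \<noteq> A n + 2"
  proof
    assume two: "A (Suc n) = A n + 2"
    obtain m where m: "m \<ge> 1" "A n + 1 = A m \<or> A n + 1 = B m"
      using A_or_B[of "A n + 1"] A_nonneg[of n] by auto
    have "A n + 1 \<noteq> A m"
      using two A_less_iff[of n m] A_less_iff[of m "Suc n"] by (auto simp del: A_less_iff)
    then have "A n + 1 = B m" using m by simp
    then show False using B_mono[of 1 m] m(1) two Suc.prems by simp
  qed
  then show ?case using A_step'[of n] Suc.IH[OF less] by auto
qed simp

lemma A_diff_real:
  assumes "1 \<le> j" "j \<le> i"
  shows "(real i - real j) * \<alpha> - 1 < A i - A j" "A i - A j < (real i - real j) * \<alpha> + 1"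
  using A_bounds[of i] A_bounds[of j] assms by (auto simp: algebra_simps)

lemma B_diff_real:
  assumes "1 \<le> j" "j \<le> i"
  shows "(real i - real j) * \<beta> - 1 < B i - B j" "B i - B j < (real i - real j) * \<beta> + 1"
  using B_bounds[of i] B_bounds[of j] assms by (auto simp: algebra_simps)

section \<open>Differences of points of \<open>S\<close>\<close>

abbreviation S :: "(int \<times> int) set" where "S \<equiv> beatty_pairs \<alpha> \<beta> \<gamma> \<delta>"
abbreviation differences :: "(int \<times> int) set" where
  "differences \<equiv> {p - q | p q. p \<in> S \<and> q \<in> S}"

lemma S_iff: "(s, t) \<in> S \<longleftrightarrow> (\<exists>n. s = A n \<and> t = B n \<or> s = B n \<and> t = A n)"
  by (auto simp: beatty_pairs_def)

definition stuck :: "int \<Rightarrow> int \<Rightarrow> bool" where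
  "stuck x y \<longleftrightarrow> (\<forall>s t. (s, t) \<in> S \<longrightarrow> s \<le> x \<longrightarrow> t \<le> y \<longrightarrow> (x - s, y - t) \<in> differences)"

lemma stuckD:
  assumes "stuck x y"
  shows "\<lbrakk>A n \<le> x; B n \<le> y\<rbrakk> \<Longrightarrow> (x - A n, y - B n) \<in> differences"
    and "\<lbrakk>B n \<le> x; A n \<le> y\<rbrakk> \<Longrightarrow> (x - B n, y - A n) \<in> differences"
  using assms unfolding stuck_def S_iff by blast+

text \<open>The steps of \<open>A\<close> from \<open>n\<close> to \<open>i\<close> add up to
  \<open>B j\<close>. Each is at most 2 and \<open>B j\<close> exceeds \<open>A j\<close> by at
  least 2, so one step fewer already covers \<open>A j\<close>. As each step of \<open>B\<close> is
  at least \<open>b0\<close>, one \<open>b0\<close> is left over.\<close>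

lemma crossed_ge:
  assumes "1 \<le> n" "1 \<le> j" "A n = A i - B j"
  shows "B n + b0 \<le> B i - A j"
proof -
  have less: "n < i"
    using assms D_ge_2[of j] A_nonneg[of j] A_less_iff[of n i] by linarith
  have "B j \<le> 2 * (int i - int n)"
    using A_diff_bounds[of n i] less assms(3) by simp
  then have "A j \<le> 2 * (int i - int n - 1)"
    using D_ge_2[of j] assms(2) by simp
  also have "\<dots> \<le> b0 * (int i - int n - 1)"
    using less b0_ge_2 by (intro mult_right_mono) auto
  finally show ?thesis
    using B_diff_ge[of n i] less assms(1) by (simp add: algebra_simps)
qed

lemma crossed_shifted_ge:
  assumes "1 \<le> n" "1 \<le> j" "A n - B 1 = A i - B j"
  shows "B n - 1 \<le> B i - A j"
proof -
  have le: "n \<le> i"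
    using assms B_mono[of 1 j] A_le_iff[of n i] by linarith
  have "2 * (int j - 1) \<le> b0 * (int j - 1)"
    using assms(2) b0_ge_2 by (intro mult_right_mono) auto
  also have "\<dots> \<le> B j - B 1"
    using B_diff_ge[of 1 j] assms(2) by simp
  also have "\<dots> \<le> 2 * (int i - int n)"
    using A_diff_bounds[of n i] le assms(3) by linarith
  also have "\<dots> \<le> b0 * (int i - int n)"
    using le b0_ge_2 by (intro mult_right_mono) auto
  also have "\<dots> \<le> B i - B n"
    using B_diff_ge[of n i] le assms(1) by simp
  finally have "2 * (int j - 1) \<le> B i - B n" .
  moreover have "A j - A 1 \<le> 2 * (int j - 1)"
    using A_diff_bounds[of 1 j] assms(2) by simp
  ultimately show ?thesis using beatty_\<alpha>_1 by linarith
qed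

section \<open>Factors of the word as differences\<close>

abbreviation w :: "letter word" where "w \<equiv> beatty_word \<alpha> \<beta> \<gamma> \<delta>"

lemma sum_subsequence:
  "i \<le> j \<Longrightarrow> sum_list (map fst (subsequence w i j)) = A j - A i"
  "i \<le> j \<Longrightarrow> sum_list (map snd (subsequence w i j)) = B j - B i"
proof (induction j)
  case (Suc j)
  { case 1 show ?case
      using 1 Suc by (cases "i = Suc j") (auto simp: subsequence_def beatty_word_def) }
  { case 2 show ?case
      using 2 Suc by (cases "i = Suc j") (auto simp: subsequence_def beatty_word_def) }
qed (simp_all add: subsequence_def)

lemma A_2: "A 2 = 2"
proof -
  obtain m where "m \<ge> 1" "2 = A m \<or> 2 = B m"
    using A_or_B[of 2] by auto
  then have "A m = 2"
    using B_mono[of 1 m] beatty_\<beta>_1 by auto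
  moreover have "A 1 < A m" "m \<noteq> 1"
    using \<open>A m = 2\<close> beatty_\<alpha>_1 by auto
  ultimately have "A 2 \<le> 2"
    using A_le_iff[of 2 m] A_less_iff[of 1 m] by simp
  moreover have "A 1 < A 2" by simp
  ultimately show ?thesis using beatty_\<alpha>_1 by linarith
qed

lemma B_diff_less: "j \<le> i \<Longrightarrow> B i - B j < (real i - real j) * \<beta> + 1"
  using B_diff_real(2)[of j i] B_bounds(2)[of i] \<delta>_le_1 by (cases "j = 0"; cases "i = 0") auto

lemma B_diff_greater: "\<lbrakk>j \<le> i; 1 \<le> j \<or> 0 < \<delta>\<rbrakk> \<Longrightarrow> (real i - real j) * \<beta> - 1 < B i - B j"
  using B_diff_real(1)[of j i] B_bounds(1)[of i] by (cases "j = 0"; cases "i = 0") auto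

text \<open>The letter \<open>w 0 = (1, B 1)\<close> is special: for positive \<delta> the bound
  \<open>\<delta> \<le> 1\<close> makes \<open>B 1\<close> one of \<open>b0\<close> and
  \<open>b0 + 1\<close>, while for negative \<delta> it can be smaller.\<close>

lemma w_letter:
  assumes "1 \<le> n \<or> 0 < \<delta>"
  shows "w n \<in> letters \<beta>"
proof -
  have "B (Suc n) - B n \<in> {b0, b0 + 1}"
  proof (cases "n = 0")
    case True
    then have "b0 - 1 < B 1" "B 1 < b0 + 2"
      using B_bounds[of 1] b0_bounds assms \<delta>_le_1 by simp_all
    then show ?thesis using True by auto
  qed (use B_step in simp)
  then show ?thesis
    using A_step'[of n] unfolding beatty_word_def letter_defs b0_def by auto
qed

lemma w_ab:
  assumes "1 \<le> i \<or> 0 < \<delta>" "i < n" "A n < B 1"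
  shows "w i \<in> {letter_a \<beta>, letter_b \<beta>}"
proof -
  have "A i < B 1" "A (Suc i) < B 1"
    using assms(2,3) A_le_iff[of i n] A_le_iff[of "Suc i" n] by linarith+
  then have "fst (w i) = 1"
    using A_eq_self[of i] A_eq_self[of "Suc i"] by (simp add: beatty_word_def)
  then show ?thesis
    using w_letter[OF assms(1)] by (auto simp: letter_defs)
qed

lemma letters_subsequence: "1 \<le> i \<or> 0 < \<delta> \<Longrightarrow> set (subsequence w i j) \<subseteq> letters \<beta>"
  unfolding set_subsequence by (intro image_subsetI w_letter) auto

lemma ab_subsequence: "\<lbrakk>1 \<le> i \<or> 0 < \<delta>; A j < B 1\<rbrakk> \<Longrightarrow> ab_word \<beta> (subsequence w i j)"
  unfolding ab_word_def set_subsequence by (intro image_subsetI w_ab) auto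

lemma factors_subsequence: "i \<le> j \<Longrightarrow> subsequence w i j \<in> factors (j - i) w"
  unfolding factors_def by (auto intro!: exI[of _ i])

end

section \<open>Stuck positions when all steps of \<open>B\<close> are at least 3\<close>

locale wide_complementary_beatty = complementary_beatty +
  assumes b0_ge_3: "3 \<le> b0"
begin

lemma \<beta>_gt_3: "3 < \<beta>"
proof -
  have "\<beta> \<noteq> 3" using \<beta>_irrational by (metis Rats_number_of)
  then show ?thesis using b0_ge_3 b0_bounds by linarith
qed

lemma B_gap: "j \<le> i \<Longrightarrow> 3 * (int i - int j) \<le> B i - B j"
proof (induction rule: dec_induct)
  case (step n)
  have "3 \<le> B (Suc n) - B n"
    using B_step[of n] b0_ge_3 B_1 by (cases "n = 0") auto
  then show ?case using step.IH by simp
qed simp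

lemma gap_mono: "j < i \<Longrightarrow> A i - A j < B i - B j"
  using A_diff_bounds[of j i] B_gap[of j i] by simp

text \<open>Apart from zero and negative differences, those with minuend \<open>(B i, A i)\<close>
  fall below the diagonal and have first coordinate at least 3. The disjunct
  \<open>x \<le> 2\<close> serves \<open>first_difference\<close>, where the point may itself lie
  below the diagonal.\<close>

lemma differences_cases [consumes 4, case_names parallel crossed]:
  assumes "(x, y) \<in> differences" "0 \<le> x" "0 \<le> y" "x \<le> y \<or> x \<le> 2"
  obtains (parallel) i j where "j \<le> i" "x = A i - A j" "y = B i - B j"
    | (crossed) i j where "1 \<le> i" "1 \<le> j" "x = A i - B j" "y = B i - A j"
proof -
  obtain s t s' t' where *: "(s, t) \<in> S" "(s', t') \<in> S" "x = s - s'" "y = t - t'"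
    using assms(1) by auto
  obtain i j where "s = A i \<and> t = B i \<or> s = B i \<and> t = A i" "s' = A j \<and> t' = B j \<or> s' = B j \<and> t' = A j"
    using *(1,2) unfolding S_iff by blast
  then consider (1) "x = A i - A j" "y = B i - B j" | (2) "x = A i - B j" "y = B i - A j"
    | (3) "x = B i - A j" "y = A i - B j" | (4) "x = B i - B j" "y = A i - A j"
    using *(3,4) by blast
  then show thesis
  proof cases
    case 1
    then have "j \<le> i" using assms(2) by simp
    then show ?thesis using 1 parallel by blast
  next
    case 2
    have "j = 0" if "i = 0"
      using 2 that assms(2) B_gap[of 0 j] by fastforce
    then consider "j = 0" | "1 \<le> i" "1 \<le> j" by fastforce
    then show ?thesis
    proof cases
      assume "j = 0"
      then show ?thesis using 2 parallel[of 0 i] by simp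
    qed (use 2 crossed in blast)
  next
    case 3
    consider "j = 0" "i = 0" | "j = 0" "1 \<le> i" | "1 \<le> j" "i = 0" | "1 \<le> j" "1 \<le> i" by fastforce
    then show ?thesis
    proof cases
      assume "j = 0" "i = 0"
      then show ?thesis using 3 parallel[of 0 0] by simp
    next
      assume "j = 0" "1 \<le> i"
      then show ?thesis using 3 assms(4) D_ge_2[of i] B_gap[of 0 i] by simp
    next
      assume "1 \<le> j" "i = 0"
      then show ?thesis using 3 assms(2) A_pos[of j] by simp
    next
      assume "1 \<le> j" "1 \<le> i"
      then have "4 \<le> x - y" using 3 D_ge_2[of i] D_ge_2[of j] by simp
      then show ?thesis using assms(3,4) by linarith
    qed
  next
    case 4
    then have "j \<le> i" using assms(3) by simp
    moreover have "\<not> j < i"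
      using 4 assms(4) gap_mono[of j i] B_gap[of j i] by auto
    ultimately show ?thesis using 4 parallel[of 0 0] by simp
  qed
qed

lemma zero_difference: "\<lbrakk>(0, z) \<in> differences; 0 \<le> z\<rbrakk> \<Longrightarrow> z = 0"
proof (erule differences_cases)
  fix i j assume "0 = A i - B j" "1 \<le> i" "1 \<le> j"
  then show ?thesis using A_neq_B[of i j] by simp
qed auto

text \<open>Subtracting the origin shows that \<open>(x, y)\<close> is a difference. Whenever a
  point of \<open>S\<close> in the same column lies no higher, subtracting it leaves first
  coordinate 0, which would put \<open>(x, y)\<close> in \<open>S\<close>. For
  \<open>y < B n\<close>, \<open>crossed_ge\<close> rules out crossed differences.\<close>

lemma stuck_parallel:
  assumes "stuck x y" "0 \<le> x" "x \<le> y" "(x, y) \<notin> S"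
  obtains n i j where "1 \<le> n" "x = A n" "y < B n" "1 \<le> j" "j < i" "x = A i - A j" "y = B i - B j"
proof -
  have S0: "(x, y) \<in> differences"
    using stuckD(1)[OF assms(1), of 0] assms by simp
  have "(0, 0) \<in> S" unfolding S_iff by (rule exI[of _ 0]) simp
  then have "x \<noteq> 0" using zero_difference[of y] S0 assms(3,4) by blast
  then obtain n where n: "1 \<le> n" "x = A n \<or> x = B n"
    using A_or_B[of x] assms(2) by auto
  have "x \<noteq> B n"
  proof
    assume x: "x = B n"
    then have "(0, y - A n) \<in> differences" "0 \<le> y - A n"
      using stuckD(2)[OF assms(1), of n] A_le_B[of n] assms(3) by auto
    then have "y = A n" using zero_difference by force
    then show False using x assms(4) S_iff by blast
  qed
  then have x: "x = A n" using n by blast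
  have y: "y < B n"
  proof (rule ccontr)
    assume "\<not> y < B n"
    then have "(0, y - B n) \<in> differences" "0 \<le> y - B n"
      using stuckD(1)[OF assms(1), of n] x by auto
    then have "y = B n" using zero_difference by force
    then show False using x assms(4) S_iff by blast
  qed
  from S0 assms(2) order_trans[OF assms(2,3)] disjI1[OF assms(3)] show thesis
  proof (cases rule: differences_cases)
    case (parallel i j)
    have "j \<noteq> 0"
    proof
      assume "j = 0"
      then have "i = n" using parallel(2) x by simp
      then show False using parallel(3) y \<open>j = 0\<close> by simp
    qed
    moreover have "j \<noteq> i"
      using parallel \<open>x \<noteq> 0\<close> by auto
    ultimately show thesis
      using that[of n j i] parallel x y n(1) by auto
  next
    case (crossed i j)
    then show thesis
      using crossed_ge[of n j i] x y n(1) b0_ge_2 by simp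
  qed
qed

text \<open>Otherwise \<open>(B 1, 1)\<close> can be subtracted, and a crossed result would give
  \<open>B n \<le> y\<close>. The parallel case depends on the sign of \<gamma> and is left to
  \<open>no_parallel\<close>.\<close>

lemma stuck_less_B1:
  assumes "stuck (A n) y" "1 \<le> n" "A n \<le> y" "y < B n"
    and no_parallel: "\<And>i j. \<lbrakk>j \<le> i; A n - B 1 = A i - A j; y - 1 = B i - B j\<rbrakk> \<Longrightarrow> False"
  shows "A n < B 1"
proof (rule ccontr)
  assume "\<not> A n < B 1"
  then have ge: "B 1 \<le> A n" by simp
  then have "(A n - B 1, y - 1) \<in> differences"
    using stuckD(2)[OF assms(1), of 1] beatty_\<alpha>_1 A_pos[OF assms(2)] assms(3) by simp
  moreover have "0 \<le> A n - B 1" "0 \<le> y - 1" "A n - B 1 \<le> y - 1 \<or> A n - B 1 \<le> 2"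
    using ge assms(3) beatty_\<beta>_1 A_pos[OF assms(2)] by auto
  ultimately show False
  proof (cases rule: differences_cases)
    case (parallel i j)
    then show False using no_parallel by blast
  next
    case (crossed i j)
    then show False using crossed_shifted_ge[of n j i] assms(2,4) by simp
  qed
qed

text \<open>Below \<open>B 1\<close> the sequence \<open>A\<close> is the identity, so
  \<open>A n - A m = A (n - m)\<close> and \<open>crossed_ge\<close> applies with index
  \<open>n - m\<close>.\<close>

lemma stuck_small:
  assumes "stuck (A n) y" "A n < B 1" "y < B n" "m < n" "B m \<le> y" "int n - int m \<le> y - B m"
  obtains (parallel) i j where "j \<le> i" "int n - int m = A i - A j" "y - B m = B i - B j"
    | (crossed) "B (n - m) + b0 \<le> y - B m"
proof -
  have less: "A m < B 1" "A (n - m) < B 1"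
    using assms(2,4) A_le_iff[of m n] A_le_iff[of "n - m" n] by linarith+
  have id: "A n = int n" "A m = int m" "A (n - m) = int n - int m"
    using A_eq_self[OF assms(2)] A_eq_self[OF less(1)] A_eq_self[OF less(2)] assms(4) by auto
  have "(A n - A m, y - B m) \<in> differences"
    using stuckD(1)[OF assms(1), of m] assms(4,5) by simp
  moreover have "0 \<le> A n - A m" "0 \<le> y - B m" "A n - A m \<le> y - B m \<or> A n - A m \<le> 2"
    using assms(4-6) id by auto
  ultimately show thesis
  proof (cases rule: differences_cases)
    case (parallel i j)
    then show thesis using that(1) id by simp
  next
    case (crossed i j)
    then have "B (n - m) + b0 \<le> B i - A j"
      using id assms(4) by (intro crossed_ge) auto
    then show thesis using that(2) crossed by simp
  qed
qed

text \<open>Parallel differences other than \<open>(A 1, B 1)\<close> rise by at least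
  \<open>b0\<close>, and so do crossed ones in the columns \<open>A 1 = 1\<close> and
  \<open>A 2 = 2\<close>.\<close>

lemma first_difference:
  assumes "(x, z) \<in> differences" "x \<in> {1, 2}" "0 \<le> z" "z < b0"
  shows "x = 1" "z = B 1"
proof -
  have "0 \<le> x" "x \<le> z \<or> x \<le> 2" using assms(2) by auto
  from assms(1) this(1) assms(3) this(2) have "x = 1 \<and> z = B 1"
  proof (cases rule: differences_cases)
    case (parallel i j)
    have "j < i"
      using parallel assms(2) by (cases "i = j") auto
    have "b0 * 1 \<le> b0 * (int i - int j)"
      using \<open>j < i\<close> b0_ge_2 by (intro mult_left_mono) auto
    then have "j = 0"
      using B_diff_ge[of j i] parallel \<open>j < i\<close> assms(4) by linarith
    have "\<not> 1 < i"
    proof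
      assume "1 < i"
      then have "b0 * 1 \<le> b0 * (int i - 1)"
        using b0_ge_2 by (intro mult_left_mono) auto
      then show False
        using B_diff_ge[of 1 i] \<open>1 < i\<close> parallel \<open>j = 0\<close> assms(4) beatty_\<beta>_1 by simp
    qed
    then have "i = 1" using \<open>j < i\<close> by simp
    then show ?thesis using parallel \<open>j = 0\<close> beatty_\<alpha>_1 by simp
  next
    case (crossed i j)
    obtain r where "1 \<le> r" "x = A r"
      using assms(2) beatty_\<alpha>_1 A_2
      by (metis insert_iff empty_iff one_le_numeral order_refl)
    then show ?thesis
      using crossed_ge[of r j i] crossed assms(4) B_nonneg[of r] by simp
  qed
  then show "x = 1" "z = B 1" by auto
qed


subsection \<open>Negative \<open>\<gamma>\<close>\<close>

text \<open>For \<open>0 < \<delta>\<close> a difference of length \<open>i - j\<close> lies within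
  1 of \<open>(i - j) * \<beta>\<close>, even if \<open>j = 0\<close>. A wrong length would be off
  by at least \<beta>, which exceeds 3.\<close>

lemma parallel_length:
  assumes "j \<le> i" "0 < \<delta>" "real k * \<beta> - 2 < B i - B j" "B i - B j < real k * \<beta>"
  shows "i - j = k"
proof -
  have "(real i - real j) * \<beta> - 1 < real k * \<beta>" "real k * \<beta> - 2 < (real i - real j) * \<beta> + 1"
    using B_diff_greater[of j i] B_diff_less[of j i] assms by linarith+
  then have "(real i - real j - real k) * \<beta> < 1 * \<beta>" "(real k - (real i - real j)) * \<beta> < 1 * \<beta>"
    using \<beta>_gt_3 by (auto simp: algebra_simps)
  then have "real i - real j - real k < 1" "real k - (real i - real j) < 1"
    using \<beta>_pos by (simp_all only: mult_less_cancel_right_pos)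
  then show ?thesis using assms(1) by linarith
qed

text \<open>With \<open>l = i - j\<close> either \<open>n = l\<close> or \<open>n = Suc l\<close>,
  and \<open>y = B l - 1\<close> in both cases. The factors found have length \<open>l - m\<close>:
  this is the whole suffix for \<open>n = l\<close>, hence (B.1), and the suffix without its last
  letter for \<open>n = Suc l\<close>, hence (B.2).\<close>

lemma stuck_suffix_bad:
  assumes "0 < \<delta>" "stuck x y" "0 \<le> x" "x \<le> y" "(x, y) \<notin> S"
  shows "\<exists>k. int k < B 1 \<and> ab_word \<beta> (prefix k w) \<and> suffix_bad \<beta> w (prefix k w)"
proof -
  obtain n i j where n: "1 \<le> n" "x = A n" "y < B n" and ij: "1 \<le> j" "j < i"
    "x = A i - A j" "y = B i - B j"
    using stuck_parallel[OF assms(2-5)] by metis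
  define l where "l = i - j"
  have l: "1 \<le> l" "real l = real i - real j"
    using ij(2) by (auto simp: l_def)
  have x_l: "real l * \<alpha> - 1 < x" "x < real l * \<alpha> + 1"
    using A_diff_real[of j i] ij l by auto
  have y_l: "real l * \<beta> - 1 < y" "y < real l * \<beta> + 1"
    using B_diff_real[of j i] ij l by auto
  have "l \<le> n"
  proof -
    have "real l * \<beta> - 1 < real n * \<beta>"
      using y_l n(3) B_bounds(2)[OF n(1)] \<delta>_le_1 by linarith
    then have "(real l - real n) * \<beta> < 1 * \<beta>"
      using \<beta>_gt_3 by (auto simp: algebra_simps)
    then have "real l - real n < 1"
      using \<beta>_pos by (simp only: mult_less_cancel_right_pos)
    then show ?thesis by linarith
  qed
  moreover have "n \<le> l + 1"
  proof -
    have "(real n - real l - 1) * \<alpha> < 1 * \<alpha>"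
      using x_l n(2) A_bounds(1)[OF n(1)] \<gamma>_bounds \<alpha>_gt_1 by (simp add: algebra_simps)
    then have "real n - real l - 1 < 1"
      using \<alpha>_pos by (simp only: mult_less_cancel_right_pos)
    then show ?thesis by linarith
  qed
  ultimately have "n = l \<or> n = Suc l" by linarith
  \<comment> \<open>The estimates allow \<open>B l - 1\<close>, \<open>B l\<close> and
    \<open>B l + 1\<close>. The last two would give a difference of height 0 or 1 in column 1 or 2,
    against \<open>first_difference\<close>.\<close>
  moreover have "y = B l - 1" if "n = Suc l"
  proof (rule ccontr)
    assume "y \<noteq> B l - 1"
    moreover have "B l - 2 < y" "y < B l + 2"
      using y_l B_diff_less[of 0 l] B_diff_greater[of 0 l] assms(1) by simp_all
    ultimately have z: "0 \<le> y - B l" "y - B l < 2" by auto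
    have "(x - A l, y - B l) \<in> differences"
      using stuckD(1)[OF assms(2), of l] that n(2) z by simp
    then show False
      using first_difference[of "x - A l" "y - B l"] A_step'[of l] that n(2) z b0_ge_3 beatty_\<beta>_1
      by simp
  qed
  moreover have "y = B l - 1" if "n = l"
  proof -
    have "B l - 2 < y"
      using y_l B_bounds(2)[OF l(1)] \<delta>_le_1 by linarith
    then show ?thesis using n(3) that by simp
  qed
  ultimately have y: "y = B l - 1" by blast
  have y_less: "y < real l * \<beta>"
    using y B_bounds(2)[OF l(1)] \<delta>_le_1 by simp
  have less: "A n < B 1"
  proof (rule stuck_less_B1)
    \<comment> \<open>This difference would again have length \<open>l\<close> and so exceed
      \<open>l * \<beta> - 1\<close>, whereas \<open>y < l * \<beta>\<close>.\<close>
    fix i' j' assume ij': "j' \<le> i'" "y - 1 = B i' - B j'"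
    then have "i' - j' = l"
      using y_l y_less assms(1) by (intro parallel_length) linarith+
    then have "real l * \<beta> - 1 < y - 1"
      using B_diff_greater[of j' i'] ij' assms(1) by (auto simp: of_nat_diff)
    then show False using y_less by simp
  qed (use assms n in auto)
  then have id: "A n = int n" by (rule A_eq_self)
  have u_ab: "ab_word \<beta> (subsequence w m k)" if "k \<le> n" for m k
    using ab_subsequence[of m k] assms(1) less that A_le_iff[of k n] by linarith
  have factor: "\<exists>v \<in> factors (l - m) w. set v \<subseteq> letters \<beta> \<and>
      sum_list (map fst v) = int n - int m \<and> sum_list (map snd v) = y - B m" if "m < l" for m
  proof -
    have "int l - int m \<ge> 1" using that by simp
    then have gap: "int n - int m \<le> y - B m"
      using B_gap[of m l] \<open>n = l \<or> n = Suc l\<close> that y by auto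
    then have "B m \<le> y" "m < n"
      using that \<open>l \<le> n\<close> by auto
    have y_m: "real (l - m) * \<beta> - 2 < y - B m" "y - B m < real (l - m) * \<beta>"
      using B_diff_less[of m l] B_diff_greater[of m l] that y assms(1) by (auto simp: of_nat_diff)
    from assms(2)[unfolded n(2)] less n(3) \<open>m < n\<close> \<open>B m \<le> y\<close> gap show ?thesis
    proof (cases rule: stuck_small)
      case (parallel i' j')
      then have "i' - j' = l - m"
        using y_m assms(1) by (intro parallel_length) auto
      then have "subsequence w j' i' \<in> factors (l - m) w"
        using factors_subsequence[OF parallel(1)] by simp
      then show ?thesis
        using parallel sum_subsequence[of j' i'] letters_subsequence[of j' i'] assms(1)
        by (intro bexI[of _ "subsequence w j' i'"]) auto
    next
      case crossed
      have "real (l - m) * \<beta> \<le> real (n - m) * \<beta>"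
        using \<open>l \<le> n\<close> \<beta>_pos by (intro mult_right_mono) auto
      then show ?thesis
        using crossed y_m B_diff_greater[of 0 "n - m"] assms(1) b0_ge_3 by simp
    qed
  qed
  have "suffix_bad \<beta> w (prefix n w)"
  proof (cases "n = l")
    case True
    have "cond_B1 \<beta> w (drop m (prefix n w))" if "m < n" for m
    proof -
      let ?u = "subsequence w m n"
      obtain v where v: "v \<in> factors (n - m) w" "set v \<subseteq> letters \<beta>"
        "sum_list (map fst v) = int n - int m" "sum_list (map snd v) = y - B m"
        using factor[of m] \<open>m < n\<close> unfolding True by blast
      have len: "length v = length ?u"
        using v(1) by (auto simp: factors_def)
      have "sum_list (map snd v) = sum_list (map snd ?u) + (- 1)"
        using sum_subsequence(2)[of m n] that v(4) y True by simp
      from parikh_shift_ab[OF u_ab v(2) len _ this] have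
        "ab_word \<beta> v" "parikh \<beta> v = parikh \<beta> ?u + (1, - 1, 0, 0)"
        using v(3) that by (auto simp: of_nat_diff)
      then show ?thesis
        using v(1) unfolding cond_B1_def by (intro bexI[of _ v]) auto
    qed
    then show ?thesis
      unfolding suffix_bad_def using n(1) factors_subsequence[of 0 n] u_ab[of n 0] by simp
  next
    case False
    then have Suc: "n = Suc l" using \<open>n = l \<or> n = Suc l\<close> by blast
    have "cond_B2 \<beta> w (drop m (prefix n w))" if "m < l" for m
    proof -
      let ?u = "subsequence w m l"
      obtain v where v: "v \<in> factors (l - m) w" "set v \<subseteq> letters \<beta>"
        "sum_list (map fst v) = int n - int m" "sum_list (map snd v) = y - B m"
        using factor[of m] \<open>m < l\<close> by blast
      have len: "length v = length ?u"
        using v(1) by (auto simp: factors_def)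
      have "sum_list (map snd v) = sum_list (map snd ?u) + (- 1)"
        using sum_subsequence(2)[of m l] that v(4) y by simp
      from parikh_shift[OF u_ab v(2) len _ this] have
        "parikh \<beta> v = parikh \<beta> ?u + (0, - 1, 1, 0) \<or> parikh \<beta> v = parikh \<beta> ?u + (1, - 2, 0, 1)"
        using v(3) that Suc by (auto simp: of_nat_diff)
      moreover have "butlast (drop m (prefix n w)) = ?u"
        using that Suc by (simp add: subsequence_def drop_map)
      ultimately show ?thesis
        using v(1) unfolding cond_B2_def has_factor_shifted_def by auto
    qed
    then show ?thesis
      unfolding suffix_bad_def
      using n(1) l(1) Suc factors_subsequence[of 0 n] u_ab[of n 0] by simp
  qed
  moreover have "int n < B 1" using less id by simp
  ultimately show ?thesis using u_ab[of n 0] by blast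
qed


subsection \<open>Positive \<open>\<gamma>\<close>\<close>

text \<open>Here \<open>n = Suc l\<close> and \<open>y = B l + B 1\<close>. The representation of
  \<open>(x, y)\<close> by \<open>i\<close> and \<open>j\<close> supplies the shifted factor, and
  \<open>reversal\<close> the palindrome.\<close>

lemma stuck_bad_prefix:
  assumes "\<delta> < 0" "stuck x y" "0 \<le> x" "x \<le> y" "(x, y) \<notin> S"
  shows "\<exists>k. 1 \<le> k \<and> int k \<le> B 1 - 2 \<and> ab_word \<beta> (subsequence w 1 (k + 1)) \<and>
    bad_prefix \<beta> w (prefix (k + 1) w)"
proof -
  have \<gamma>: "0 < \<gamma>" using assms(1) offset_signs by simp
  obtain n i j where n: "1 \<le> n" "x = A n" "y < B n" and ij: "1 \<le> j" "j < i"
    "x = A i - A j" "y = B i - B j"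
    using stuck_parallel[OF assms(2-5)] by metis
  define l where "l = i - j"
  have l: "1 \<le> l" "real l = real i - real j"
    using ij(2) by (auto simp: l_def)
  have x_l: "real l * \<alpha> - 1 < x" "x < real l * \<alpha> + 1"
    using A_diff_real[of j i] ij l by auto
  have y_l: "real l * \<beta> - 1 < y" "y < real l * \<beta> + 1"
    using B_diff_real[of j i] ij l by auto
  have "l < n"
  proof -
    have "real l * \<beta> < real n * \<beta>"
      using y_l n(3) B_bounds(2)[OF n(1)] assms(1) by linarith
    then show ?thesis using \<beta>_pos by simp
  qed
  moreover have "n < l + 2"
  proof -
    have "(real n - real l) * \<alpha> < 2 * \<alpha>"
      using x_l n(2) A_bounds(1)[OF n(1)] \<gamma> \<alpha>_gt_1 by (simp add: algebra_simps)
    then have "real n - real l < 2"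
      using \<alpha>_pos by (simp only: mult_less_cancel_right_pos)
    then show ?thesis by linarith
  qed
  ultimately have Suc: "n = Suc l" by linarith
  \<comment> \<open>The bound \<open>3 - \<beta> < \<delta>\<close> keeps this height below
    \<open>b0\<close>, so that \<open>first_difference\<close> identifies it as
    \<open>B 1\<close>.\<close>
  have z: "0 \<le> y - B l" "y - B l < 2 - \<delta>" "y - B l < b0"
    using y_l B_bounds[OF l(1)] assms(1) \<delta>_ge b0_bounds by linarith+
  have "(x - A l, y - B l) \<in> differences"
    using stuckD(1)[OF assms(2), of l] Suc n(2) z by simp
  then have "x - A l = 1" "y - B l = B 1"
    using first_difference[of "x - A l" "y - B l"] A_step'[of l] Suc n(2) z by simp_all
  then have y: "y = B l + B 1" and B1: "B 1 < 2 - \<delta>"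
    using z(2) by auto
  have less: "A n < B 1"
  proof (rule stuck_less_B1)
    \<comment> \<open>The height \<open>y - 1\<close> forces length at least \<open>l\<close>, hence
      first coordinate above \<open>l * \<alpha> - 1\<close>; but \<open>A n - B 1\<close> is below
      \<open>l * \<alpha> - 2\<close>.\<close>
    fix i' j' assume ij': "j' \<le> i'" "A n - B 1 = A i' - A j'" "y - 1 = B i' - B j'"
    have "real l * \<beta> - 1 - 1 < (real i' - real j') * \<beta> + 1"
      using B_diff_less[OF ij'(1)] ij'(3) y_l by linarith
    then have "(real l - (real i' - real j')) * \<beta> < 1 * \<beta>"
      using \<beta>_gt_3 by (simp add: algebra_simps)
    then have "real l - (real i' - real j') < 1"
      using \<beta>_pos by (simp only: mult_less_cancel_right_pos)
    then have "int l \<le> int i' - int j'"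
      by linarith
    then have "real l \<le> real i' - real j'"
      by linarith
    then have "real l * \<alpha> \<le> (real i' - real j') * \<alpha>"
      using \<alpha>_pos by (intro mult_right_mono) auto
    moreover have "(real i' - real j') * \<alpha> - 1 < A i' - A j'"
      using A_diff_real(1)[of j' i'] A_bounds(1)[of i'] \<gamma> ij'(1)
      by (cases "j' = 0"; cases "i' = 0") auto
    ultimately show False
      using ij'(2) x_l n(2) beatty_\<beta>_1 by linarith
  qed (use assms n in auto)
  have id: "A k = int k" if "k \<le> n" for k
    using A_eq_self[of k] less A_le_iff[of k n] that by linarith
  have stuck_n: "stuck (A n) y"
    using assms(2) n(2) by simp
  text \<open>The difference to the pair of index \<open>n - k\<close> is the pair of index \<open>k\<close>.\<close>
  have reversal: "B l + B 1 = B k + B (n - k)" if "1 \<le> k" "k \<le> l" for k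
    using that
  proof (induction k rule: nat_induct_at_least)
    case base
    then show ?case using Suc by simp
  next
    case (Suc k)
    define m where "m = n - Suc k"
    have m: "Suc m = n - k" "1 \<le> m" "m < n" "int n - int m = int (Suc k)" "n - m = Suc k"
      using Suc.prems \<open>n = Suc l\<close> by (auto simp: m_def of_nat_diff)
    define z where "z = y - B m"
    have "z = B k + (B (Suc m) - B m)"
      using Suc m(1) y by (simp add: z_def)
    then have z_B: "z = B k + b0 \<or> z = B k + b0 + 1"
      using B_step[OF m(2)] by auto
    have "3 * int k \<le> B k" using B_gap[of 0 k] by simp
    then have "int (Suc k) \<le> z"
      using z_B b0_ge_3 by auto
    then have "B m \<le> y" "int n - int m \<le> y - B m"
      using m(4) by (auto simp: z_def)
    with stuck_n less n(3) m(3) have "z = B (Suc k)"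
    proof (cases rule: stuck_small)
      case (parallel i' j')
      show ?thesis
      proof (cases "j' = 0")
        case True
        then have "A i' = A (Suc k)"
          using parallel(2) m(4) id[of "Suc k"] Suc.prems \<open>n = Suc l\<close> by simp
        then have "i' = Suc k" by simp
        then show ?thesis using parallel(3) True by (simp add: z_def)
      next
        \<comment> \<open>Without index 0 the length is at least \<open>k + 1\<close>, which forces
          \<open>-2 < \<delta>\<close> and thus \<open>B 1 < 4\<close>. However,
          \<open>1 \<le> k < l\<close> gives \<open>3 \<le> n < B 1\<close>.\<close>
        case False
        have z_k: "real k * \<beta> + \<delta> - 1 + b0 < z" "z < real k * \<beta> + \<delta> + b0 + 1"
          using z_B B_bounds[OF Suc.hyps] by auto
        have z_l: "(real i' - real j') * \<beta> - 1 < z" "z < (real i' - real j') * \<beta> + 1"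
          using B_diff_real[of j' i'] parallel False by (auto simp: z_def)
        have "real k * \<beta> < (real i' - real j') * \<beta>"
          using z_k z_l b0_bounds \<delta>_ge by linarith
        then have "real k < real i' - real j'"
          using \<beta>_pos by (simp only: mult_less_cancel_right_pos)
        then have "int k + 1 \<le> int i' - int j'"
          by linarith
        then have "real k + 1 \<le> real i' - real j'"
          by linarith
        then have "(real k + 1) * \<beta> \<le> (real i' - real j') * \<beta>"
          using \<beta>_pos by (intro mult_right_mono) auto
        then have "- 2 < \<delta>"
          using z_k z_l b0_bounds by (simp add: algebra_simps)
        then have "B 1 < 4" using B1 by linarith
        then show ?thesis
          using less id[of n] Suc.prems Suc.hyps \<open>n = Suc l\<close> by simp
      qed
    next
      case crossed
      then show ?thesis
        using B_step[OF Suc.hyps] z_B m(5) b0_ge_3 by (auto simp: z_def)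
    qed
    then show ?case
      using y by (simp add: z_def m_def)
  qed
  let ?u = "subsequence w 1 n" and ?v = "subsequence w j i"
  have u_ab: "ab_word \<beta> ?u"
    using less by (intro ab_subsequence) auto
  have "rev (butlast ?u) = butlast ?u"
  proof (rule nth_equalityI)
    fix m assume "m < length (rev (butlast ?u))"
    then have m: "m < l - 1" using Suc by simp
    have "A (Suc (Suc m)) - A (Suc m) = A (l - m) - A (l - m - 1)"
      using m Suc by (simp add: id of_nat_diff)
    \<comment> \<open>Two consecutive instances of \<open>reversal\<close> are subtracted.\<close>
    moreover have "B (Suc (Suc m)) - B (Suc m) = B (l - m) - B (l - m - 1)"
      using reversal[of "Suc m"] reversal[of "Suc (Suc m)"] m Suc by (simp add: less_diff_conv)
    moreover have idx: "Suc (l - m - 1) = l - m" "Suc (l - Suc (Suc m)) = l - m - 1"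
      using m by auto
    ultimately have "w (Suc m) = w (l - m - 1)"
      by (simp add: beatty_word_def)
    moreover have "rev (butlast ?u) ! m = w (l - m - 1)" "butlast ?u ! m = w (Suc m)"
      using m Suc idx by (auto simp: rev_nth nth_butlast)
    ultimately show "rev (butlast ?u) ! m = butlast ?u ! m" by simp
  qed simp
  moreover have w_0: "snd (w 0) = B 1"
    by (simp add: beatty_word_def)
  moreover have "last ?u = w l"
    using Suc l(1) by (simp add: subsequence_def)
  then have last: "snd (last ?u) = B n - B l"
    using Suc by (simp add: beatty_word_def)
  \<comment> \<open>The second coordinates add up to \<open>y = B l + B 1\<close> in
    \<open>?v\<close> and to \<open>B n - B 1\<close> in \<open>?u\<close>; \<open>t\<close> is the
    difference of these sums.\<close>
  define t where "t = 2 * B 1 - (B n - B l)"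
  have shift: "has_factor_shifted \<beta> w ?u (- 1 - t, t, 1, 0) \<or>
      has_factor_shifted \<beta> w ?u (- t, t - 1, 0, 1)"
  proof -
    have v: "set ?v \<subseteq> letters \<beta>"
      using ij(1) by (intro letters_subsequence) auto
    have "parikh \<beta> ?v = parikh \<beta> ?u + (- 1 - t, t, 1, 0) \<or>
      parikh \<beta> ?v = parikh \<beta> ?u + (- t, t - 1, 0, 1)"
    proof (rule parikh_shift[OF u_ab v])
      show "length ?v = length ?u"
        using Suc l_def by simp
      show "sum_list (map fst ?v) = int (length ?u) + 1"
        using sum_subsequence(1)[of j i] ij n(2) id[of n] Suc by simp
      show "sum_list (map snd ?v) = sum_list (map snd ?u) + t"
        using sum_subsequence(2)[of j i] sum_subsequence(2)[of 1 n] ij y n(1) t_def by simp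
    qed
    moreover have "?v \<in> factors (length ?u) w"
      using factors_subsequence[of j i] ij(2) Suc by (simp flip: l_def)
    ultimately show ?thesis
      unfolding has_factor_shifted_def by blast
  qed
  \<comment> \<open>Both \<open>y\<close> and \<open>B n - B 1\<close> lie within 1 of
    \<open>l * \<beta>\<close>, which leaves three values of \<open>t\<close>, one for each
    clause.\<close>
  have "real l * \<beta> - 1 < B n - B 1" "B n - B 1 < real l * \<beta> + 1"
    using B_diff_real[of 1 n] Suc by simp_all
  then have "- 2 < t" "t < 2"
    using y_l y unfolding t_def by linarith+
  then consider "t = - 1" | "t = 0" | "t = 1" by linarith
  then have cases: "2 * snd (w 0) = snd (last ?u) - 1 \<and>
         (has_factor_shifted \<beta> w ?u (0, -1, 1, 0) \<or> has_factor_shifted \<beta> w ?u (1, -2, 0, 1)) \<or>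
       2 * snd (w 0) = snd (last ?u) \<and>
         (has_factor_shifted \<beta> w ?u (-1, 0, 1, 0) \<or> has_factor_shifted \<beta> w ?u (0, -1, 0, 1)) \<or>
       2 * snd (w 0) = snd (last ?u) + 1 \<and>
         (has_factor_shifted \<beta> w ?u (-1, 0, 0, 1) \<or> has_factor_shifted \<beta> w ?u (-2, 1, 1, 0))"
  proof cases
    case 1
    then show ?thesis using shift unfolding w_0 last t_def[symmetric] by (simp add: t_def)
  next
    case 2
    then show ?thesis using shift unfolding w_0 last by (simp add: t_def)
  next
    case 3
    then show ?thesis using shift unfolding w_0 last by (auto simp add: t_def)
  qed
  moreover have "?u \<noteq> []" "prefix n w = w 0 # ?u"
    using Suc l(1) by (simp_all add: subsequence_def upt_conv_Cons del: upt_Suc)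
  ultimately have "bad_prefix \<beta> w (prefix n w)"
    unfolding bad_prefix_def using u_ab by (intro exI[of _ ?u]) simp
  moreover have "int l \<le> B 1 - 2"
    using less id[of n] Suc by simp
  ultimately show ?thesis
    using l(1) u_ab Suc by (intro exI[of _ l]) simp
qed

end

section \<open>Lower bound on \<open>b0\<close> from goodness, and reduction to ordered
  positions\<close>

context complementary_beatty
begin

text \<open>
  If \<open>\<lfloor>\<beta>\<rfloor> = 2\<close>, then \<open>\<gamma> < 0\<close> and \<open>w\<^sub>0 = b\<close>, and an occurrence of \<open>a\<close> or \<open>c\<close> makes a prefix of length \<open>1\<close>
  or \<open>2\<close> suffix-bad; without \<open>a\<close> and \<open>c\<close> the slope of \<open>B\<close> would be \<open>3\<close>.
\<close>

lemma b0_ge_3_if_good: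
  assumes good: "good \<alpha> \<beta> \<gamma> \<delta>"
  shows "3 \<le> b0"
proof (cases "0 < \<delta>")
  case False
  then have "3 < \<beta>" using \<delta>_ge by simp
  then show ?thesis unfolding b0_def by linarith
next
  case \<delta>: True
  show ?thesis
  proof (rule ccontr)
    assume "\<not> ?thesis"
    then have b0: "b0 = 2" using b0_ge_2 by simp
    then have \<beta>: "\<beta> < 3" using b0_bounds by simp
    have B1: "B 1 = 3"
      using B_bounds(2)[of 1] \<beta> \<delta>_le_1 beatty_\<beta>_1 by simp
    have no_bad: "\<not> suffix_bad \<beta> w (prefix k w)" if "int k < 3" "ab_word \<beta> (prefix k w)" for k
      using good that \<delta> offset_signs B1 unfolding good_def Let_def by auto
    have w_0: "w 0 = letter_b \<beta>"
      using beatty_\<alpha>_1 B1 b0 by (simp add: beatty_word_def letter_b_def b0_def)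
    have prefix_1: "prefix 1 w = [w 0]" and prefix_2: "prefix 2 w = [w 0, w 1]"
      by (simp_all add: subsequence_def numeral_2_eq_2)
    have ab: "ab_word \<beta> (prefix 1 w)" "ab_word \<beta> (prefix 2 w)"
      by (rule ab_subsequence; use A_2 B1 \<delta> beatty_\<alpha>_1 in linarith)+
    have in_factors: "[w m] \<in> factors 1 w" for m
      using factors_subsequence[of m "Suc m"] by simp
    have "w m \<noteq> letter_a \<beta>" for m
    proof
      assume m: "w m = letter_a \<beta>"
      have "parikh \<beta> [w m] = parikh \<beta> [w 0] + (1, - 1, 0, 0)" "ab_word \<beta> [w m]"
        unfolding m w_0 by (simp_all add: parikh_def ab_word_def letter_defs)
      then have "cond_B1 \<beta> w [w 0]"
        unfolding cond_B1_def using in_factors[of m] by (intro bexI[of _ "[w m]"]) auto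
      then have "suffix_bad \<beta> w (prefix 1 w)"
        unfolding suffix_bad_def using ab(1) factors_subsequence[of 0 1] prefix_1 by simp
      then show False using no_bad[of 1] ab(1) by simp
    qed
    moreover have "w m \<noteq> letter_c \<beta>" for m
    proof
      assume m: "w m = letter_c \<beta>"
      have "parikh \<beta> [w m] = parikh \<beta> [w 0] + (0, - 1, 1, 0)"
        unfolding m w_0 by (simp add: parikh_def letter_defs)
      then have "cond_B2 \<beta> w [w 0, w 1]"
        unfolding cond_B2_def has_factor_shifted_def using in_factors[of m] by auto
      then have "suffix_bad \<beta> w (prefix 2 w)"
        unfolding suffix_bad_def using ab(2) factors_subsequence[of 0 2] prefix_2 by (simp add: numeral_2_eq_2)
      then show False using no_bad[of 2] ab(2) by simp
    qed
    ultimately have "w m \<in> {letter_b \<beta>, letter_d \<beta>}" for m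
      using w_letter[of m] \<delta> by auto
    then have step: "B (Suc m) - B m = 3" for m
      using b0 by (auto simp: beatty_word_def letter_defs b0_def dest!: meta_spec[of _ m])
    have B: "B m = 3 * int m" for m
    proof (induction m)
      case (Suc m)
      then show ?case using step[of m] by simp
    qed simp
    \<comment> \<open>For this \<open>m\<close> the gap \<open>m * (3 - \<beta>)\<close> exceeds 1
      and hence \<delta>, against \<open>3 * m = B m < m * \<beta> + \<delta>\<close>.\<close>
    obtain m :: nat where m: "1 / (3 - \<beta>) < real m"
      using reals_Archimedean2 by blast
    then have "1 < real m * (3 - \<beta>)"
      using \<beta> by (simp add: field_simps)
    moreover have "1 \<le> m"
      using m \<beta> by (cases m) (auto simp: field_simps)
    ultimately show False
      using B_bounds(2)[of m] B[of m] \<delta>_le_1 by (simp add: algebra_simps)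
  qed
qed

text \<open>Swapping coordinates preserves \<open>S\<close> and \<open>differences\<close>, so
  \<open>x \<le> y\<close> may be assumed. The signs of \<gamma> and \<delta> are opposite, so the
  sign of \<delta> selects the alternative in \<open>good\<close>.\<close>

lemma escape:
  assumes "\<delta> \<noteq> 0" "good \<alpha> \<beta> \<gamma> \<delta>" "0 \<le> x" "0 \<le> y" "(x, y) \<notin> S"
  shows "\<not> stuck x y"
proof
  interpret wide_complementary_beatty \<alpha> \<beta> \<gamma> \<delta>
    using b0_ge_3_if_good[OF assms(2)] by unfold_locales
  have ordered: False if "stuck x y" "0 \<le> x" "x \<le> y" "(x, y) \<notin> S" for x y
  proof (cases "0 < \<delta>")
    case True
    then show False
      using stuck_suffix_bad[OF True that] assms(2) offset_signs unfolding good_def Let_def by auto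
  next
    case False
    then have "\<delta> < 0" using assms(1) by simp
    then show False
      using stuck_bad_prefix[OF _ that] assms(2) offset_signs unfolding good_def Let_def by auto
  qed
  have S_swap: "(s, t) \<in> S \<longleftrightarrow> (t, s) \<in> S" for s t
    unfolding S_iff by blast
  have differences_swap: "(t, s) \<in> differences" if "(s, t) \<in> differences" for s t
  proof -
    obtain a b c d where "(a, b) \<in> S" "(c, d) \<in> S" "s = a - c" "t = b - d"
      using \<open>(s, t) \<in> differences\<close> by auto
    then have "(b, a) \<in> S" "(d, c) \<in> S" "(t, s) = (b, a) - (d, c)"
      using S_swap by auto
    then show ?thesis by blast
  qed
  assume stuck: "stuck x y"
  then have "stuck y x"
    unfolding stuck_def using S_swap differences_swap by blast
  then show False
    using ordered[of x y] ordered[of y x] stuck assms(3-5) S_swap linear by blast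
qed

end

theorem theorem4:
  fixes \<alpha> \<beta> \<gamma> \<delta> :: real
  assumes "0 < \<alpha>" and "\<alpha> < \<beta>"
    and "\<alpha> \<notin> \<rat>" and "\<beta> \<notin> \<rat>"
    and "1 / \<alpha> + 1 / \<beta> = 1"
    and "\<gamma> \<noteq> 0"
    and "\<gamma> / \<alpha> + \<delta> / \<beta> = 0"
    and "\<And>n::nat. n \<ge> 1 \<Longrightarrow> real n * \<beta> + \<delta> \<notin> \<int>"
    and "beatty \<alpha> \<gamma> 1 = 1" and "beatty \<beta> \<delta> 1 \<ge> 3"
    and "good \<alpha> \<beta> \<gamma> \<delta>"
  shows "int_pair ` {p. P_position (difference_free_moves (beatty_pairs \<alpha> \<beta> \<gamma> \<delta>)) p}
           = beatty_pairs \<alpha> \<beta> \<gamma> \<delta>"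
proof -
  interpret complementary_beatty \<alpha> \<beta> \<gamma> \<delta>
    by unfold_locales (use assms in auto)
  have "\<delta> \<noteq> 0"
    using assms(1,6,7) by auto
  show ?thesis
  proof (rule P_positions_eq_if_escape)
    show "0 \<le> s \<and> 0 \<le> t" if "(s, t) \<in> S" for s t
      using that A_nonneg B_nonneg unfolding S_iff by auto
    show "\<exists>s t. (s, t) \<in> S \<and> s \<le> x \<and> t \<le> y \<and> (x - s, y - t) \<notin> differences"
      if "0 \<le> x" "0 \<le> y" "(x, y) \<notin> S" for x y
      using escape[OF \<open>\<delta> \<noteq> 0\<close> assms(11) that] unfolding stuck_def by blast
  qed
qed

end
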